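(* Let $f,g:H\to H$ be functions of a quaternion variable $q$ that are differentiable (as functions of the four real components of $q$). Then $$\nabla_q(fg)=f\,\nabla_q g+\big[(\nabla_r f)\,g\big]J^{H},$$ where $f\,\nabla_q g$ is the row vector obtained by multiplying each entry of $\nabla_q g$ by $f$ from the left, $(\nabla_r f)g$ is the row vector obtained by multiplying each entry of $\nabla_r f$ by $g$ from the right, and $J^H$ is the Hermitian (conjugate) transpose of $$J=\frac14\begin{bmatrix}1&i&j&k\\1&i&-j&-k\\1&-i&j&-k\\1&-i&-j&k\end{bmatrix}.$$
   Context: $H$ denotes the real algebra of quaternions $q=q_a+q_bi+q_cj+q_dk$ ($q_a,q_b,q_c,q_d\in\mathbb{R}$). A function $f:H\to H$ is viewed as a function of the four real variables $q_a,q_b,q_c,q_d$, and $\nabla_r f:=(\partial f/\partial q_a,\partial f/\partial q_b,\partial f/\partial q_c,\partial f/\partial q_d)$ is the row vector of quaternion-valued partial derivatives. The (left) restricted HR gradient is the row vector $$\nabla_q f=\left(\frac{\partial f}{\partial q},\frac{\partial f}{\partial q^i},\frac{\partial f}{\partial q^j},\frac{\partial f}{\partial q^k}\right):=(\nabla_r f)\,J^{H},$$ so that e.g. $\frac{\partial f}{\partial q}=\frac14\left(\frac{\partial f}{\partial q_a}-\frac{\partial f}{\partial q_b}i-\frac{\partial f}{\partial q_c}j-\frac{\partial f}{\partial q_d}k\right)$. In a matrix product the row entry multiplies from the left. *)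

theory Defs
  imports "HOL-Analysis.Analysis"
begin

section \<open>The real algebra of quaternions\<close>

datatype quat = Quat (qa: real) (qb: real) (qc: real) (qd: real)

lemma quat_eq_iff: "x = y \<longleftrightarrow> qa x = qa y \<and> qb x = qb y \<and> qc x = qc y \<and> qd x = qd y"
  by (cases x; cases y) simp

instantiation quat :: ring_1
begin

definition "0 = Quat 0 0 0 0"

definition "1 = Quat 1 0 0 0"

definition "x + y = Quat (qa x + qa y) (qb x + qb y) (qc x + qc y) (qd x + qd y)"

definition "- x = Quat (- qa x) (- qb x) (- qc x) (- qd x)"

definition "x - y = Quat (qa x - qa y) (qb x - qb y) (qc x - qc y) (qd x - qd y)"

definition "x * y = Quat
  (qa x * qa y - qb x * qb y - qc x * qc y - qd x * qd y)
  (qa x * qb y + qb x * qa y + qc x * qd y - qd x * qc y)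
  (qa x * qc y - qb x * qd y + qc x * qa y + qd x * qb y)
  (qa x * qd y + qb x * qc y - qc x * qb y + qd x * qa y)"

instance
  by standard (simp_all add: quat_eq_iff zero_quat_def one_quat_def plus_quat_def
      uminus_quat_def minus_quat_def times_quat_def algebra_simps)

end

lemma quat_sel_simps [simp]:
  "qa 0 = 0" "qb 0 = 0" "qc 0 = 0" "qd 0 = 0"
  "qa 1 = 1" "qb 1 = 0" "qc 1 = 0" "qd 1 = 0"
  "qa (x + y) = qa x + qa y" "qb (x + y) = qb x + qb y"
  "qc (x + y) = qc x + qc y" "qd (x + y) = qd x + qd y"
  "qa (- x) = - qa x" "qb (- x) = - qb x" "qc (- x) = - qc x" "qd (- x) = - qd x"
  "qa (x - y) = qa x - qa y" "qb (x - y) = qb x - qb y"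
  "qc (x - y) = qc x - qc y" "qd (x - y) = qd x - qd y"
  "qa (x * y) = qa x * qa y - qb x * qb y - qc x * qc y - qd x * qd y"
  "qb (x * y) = qa x * qb y + qb x * qa y + qc x * qd y - qd x * qc y"
  "qc (x * y) = qa x * qc y - qb x * qd y + qc x * qa y + qd x * qb y"
  "qd (x * y) = qa x * qd y + qb x * qc y - qc x * qb y + qd x * qa y"
  by (simp_all add: zero_quat_def one_quat_def plus_quat_def uminus_quat_def minus_quat_def
      times_quat_def)

instantiation quat :: real_algebra_1
begin

definition "r *\<^sub>R x = Quat (r * qa x) (r * qb x) (r * qc x) (r * qd x)"

instance
  by standard (simp_all add: quat_eq_iff scaleR_quat_def algebra_simps)

end

lemma quat_sel_scaleR [simp]:
  "qa (r *\<^sub>R x) = r * qa x" "qb (r *\<^sub>R x) = r * qb x"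
  "qc (r *\<^sub>R x) = r * qc x" "qd (r *\<^sub>R x) = r * qd x"
  by (simp_all add: scaleR_quat_def)

instantiation quat :: real_inner
begin

definition "inner x y = qa x * qa y + qb x * qb y + qc x * qc y + qd x * qd y" for x y :: quat

definition "norm x = sqrt (inner x x)" for x :: quat

definition "sgn x = x /\<^sub>R norm x" for x :: quat

definition "dist x y = norm (x - y)" for x y :: quat

definition uniformity_quat_def [code del]:
  "(uniformity :: (quat \<times> quat) filter) = (INF e\<in>{0 <..}. principal {(x, y). dist x y < e})"

definition open_quat_def [code del]:
  "open (U :: quat set) \<longleftrightarrow> (\<forall>x\<in>U. eventually (\<lambda>(x', y). x' = x \<longrightarrow> y \<in> U) uniformity)"

instance
proof
  fix x y z :: quat and r :: real
  show "0 \<le> inner x x"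
    by (simp add: inner_quat_def)
  show "inner x x = 0 \<longleftrightarrow> x = 0"
  proof
    assume "inner x x = 0"
    then have s: "qa x ^ 2 + qb x ^ 2 + qc x ^ 2 + qd x ^ 2 = 0"
      by (simp add: inner_quat_def power2_eq_square)
    then have "qa x ^ 2 = 0 \<and> qb x ^ 2 = 0 \<and> qc x ^ 2 = 0 \<and> qd x ^ 2 = 0"
      by (smt (verit) zero_le_power2)
    then show "x = 0"
      by (simp add: quat_eq_iff)
  qed (simp add: inner_quat_def)
qed (simp_all add: norm_quat_def sgn_quat_def dist_quat_def uniformity_quat_def open_quat_def
    inner_quat_def algebra_simps)

end

lemma norm_quat_mult: "norm (x * y) = norm x * norm y" for x y :: quat
  unfolding norm_quat_def inner_quat_def real_sqrt_mult [symmetric]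
  by (rule arg_cong [where f = sqrt]) (simp add: algebra_simps)

instance quat :: real_normed_algebra_1
  by standard (simp_all add: norm_quat_mult, simp add: norm_quat_def inner_quat_def)

definition qi :: quat where "qi = Quat 0 1 0 0"

definition qj :: quat where "qj = Quat 0 0 1 0"

definition qk :: quat where "qk = Quat 0 0 0 1"

lemma quat_decompose:
  "q = of_real (qa q) + of_real (qb q) * qi + of_real (qc q) * qj + of_real (qd q) * qk"
  by (simp add: quat_eq_iff of_real_def qi_def qj_def qk_def)

lemma quat_unit_mult:
  "qi * qi = -1" "qj * qj = -1" "qk * qk = -1"
  "qi * qj = qk" "qj * qk = qi" "qk * qi = qj"
  "qj * qi = - qk" "qk * qj = - qi" "qi * qk = - qj"
  by (simp_all add: quat_eq_iff qi_def qj_def qk_def)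

definition qcnj :: "quat \<Rightarrow> quat" where
  "qcnj q = Quat (qa q) (- qb q) (- qc q) (- qd q)"

section \<open>The restricted HR gradient\<close>

text \<open>Row vectors with four quaternion entries have type \<open>quat ^ 4\<close>.  Quaternion multiplication
  is not commutative; \<open>v*\<close> and \<open>*s\<close> both put the row entry, respectively the scalar, on the left
  of the product.\<close>

definition real_grad :: "(quat \<Rightarrow> quat) \<Rightarrow> quat \<Rightarrow> quat ^ 4" where
  "real_grad f q = vector
    [vector_derivative (\<lambda>t. f (Quat t (qb q) (qc q) (qd q))) (at (qa q)),
     vector_derivative (\<lambda>t. f (Quat (qa q) t (qc q) (qd q))) (at (qb q)),
     vector_derivative (\<lambda>t. f (Quat (qa q) (qb q) t (qd q))) (at (qc q)),
     vector_derivative (\<lambda>t. f (Quat (qa q) (qb q) (qc q) t)) (at (qd q))]"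

definition hermitian_transpose :: "quat ^ 'n ^ 'm \<Rightarrow> quat ^ 'm ^ 'n" where
  "hermitian_transpose A = (\<chi> i j. qcnj (A $ j $ i))"

definition right_mult :: "quat ^ 'n \<Rightarrow> quat \<Rightarrow> quat ^ 'n" where
  "right_mult v c = (\<chi> i. v $ i * c)"

definition J :: "quat ^ 4 ^ 4" where
  "J = (1 / 4) *\<^sub>R vector
    [vector [1,  qi,  qj,  qk],
     vector [1,  qi, -qj, -qk],
     vector [1, -qi,  qj, -qk],
     vector [1, -qi, -qj,  qk]]"

definition HR_grad :: "(quat \<Rightarrow> quat) \<Rightarrow> quat \<Rightarrow> quat ^ 4" where
  "HR_grad f q = real_grad f q v* hermitian_transpose J"

lemma vector_4_nth:
  "(vector [a, b, c, d] :: 'a::zero ^ 4) $ 1 = a"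
  "(vector [a, b, c, d] :: 'a::zero ^ 4) $ 2 = b"
  "(vector [a, b, c, d] :: 'a::zero ^ 4) $ 3 = c"
  "(vector [a, b, c, d] :: 'a::zero ^ 4) $ 4 = d"
  unfolding vector_def by simp_all

lemma HR_grad_1:
  "HR_grad f q $ 1 = (1 / 4) *\<^sub>R (real_grad f q $ 1 - real_grad f q $ 2 * qi
     - real_grad f q $ 3 * qj - real_grad f q $ 4 * qk)"
  by (simp add: HR_grad_def vector_matrix_mult_def hermitian_transpose_def J_def sum_4
      vector_4_nth quat_eq_iff qcnj_def qi_def qj_def qk_def algebra_simps)

end

theory Submission
  imports Defs
begin

text \<open>The four entries of \<open>real_grad f q\<close> are derivatives of \<open>f\<close> along affine lines in a
  coordinate direction, and quaternion multiplication is a bounded bilinear map over the reals.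
  Each entry therefore obeys the Leibniz rule with the order of the factors kept, which gives
  \<open>real_grad (f g) = f \<cdot> real_grad g + (real_grad f) \<cdot> g\<close>.  It remains to multiply by
  \<open>J\<^sup>H\<close> on the right: left multiplication by \<open>f\<close> commutes with this
  by associativity, so the first term becomes \<open>f\<close> times the HR gradient of \<open>g\<close>.  In the second
  term the factor \<open>g\<close> stands between \<open>real_grad f\<close> and \<open>J\<^sup>H\<close>, and it cannot be moved past
  \<open>J\<^sup>H\<close> because the entries of \<open>J\<^sup>H\<close> do not commute with \<open>g\<close>; this is why the rule is
  not symmetric in \<open>f\<close> and \<open>g\<close>.\<close>

lemma differentiable_on_line:
  fixes f :: "'a::real_normed_vector \<Rightarrow> 'b::real_normed_vector"
  assumes "f differentiable (at (p + s *\<^sub>R u))"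
  shows "(\<lambda>t. f (p + t *\<^sub>R u)) differentiable (at s)"
proof -
  have "(f \<circ> (\<lambda>t. p + t *\<^sub>R u)) differentiable (at s)"
    by (rule differentiable_chain_at) (use assms in \<open>auto intro!: derivative_intros\<close>)
  then show ?thesis
    by (simp add: o_def)
qed

lemma vector_derivative_mult:
  fixes F G :: "real \<Rightarrow> 'a::real_normed_algebra"
  assumes "F differentiable (at s)" and "G differentiable (at s)"
  shows "vector_derivative (\<lambda>t. F t * G t) (at s) =
    F s * vector_derivative G (at s) + vector_derivative F (at s) * G s"
  using assms
  by (intro vector_derivative_at has_vector_derivative_mult) (simp_all add: vector_derivative_works)

text \<open>Writing the coordinate lines as affine lines reduces their differentiability to that of
  an arbitrary line.\<close>

lemma quat_coordinate_lines:
  "Quat t b c d = Quat 0 b c d + t *\<^sub>R 1"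
  "Quat a t c d = Quat a 0 c d + t *\<^sub>R qi"
  "Quat a b t d = Quat a b 0 d + t *\<^sub>R qj"
  "Quat a b c t = Quat a b c 0 + t *\<^sub>R qk"
  by (simp_all add: quat_eq_iff qi_def qj_def qk_def)

lemma differentiable_on_coordinate_lines:
  fixes f :: "quat \<Rightarrow> quat"
  assumes "f differentiable (at q)"
  shows "(\<lambda>t. f (Quat t (qb q) (qc q) (qd q))) differentiable (at (qa q))"
    and "(\<lambda>t. f (Quat (qa q) t (qc q) (qd q))) differentiable (at (qb q))"
    and "(\<lambda>t. f (Quat (qa q) (qb q) t (qd q))) differentiable (at (qc q))"
    and "(\<lambda>t. f (Quat (qa q) (qb q) (qc q) t)) differentiable (at (qd q))"
proof -
  have line: "(\<lambda>t. f (p + t *\<^sub>R u)) differentiable (at s)" if "p + s *\<^sub>R u = q" for p s u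
    using differentiable_on_line [of f p s u] assms that by simp
  show "(\<lambda>t. f (Quat t (qb q) (qc q) (qd q))) differentiable (at (qa q))"
    by (subst quat_coordinate_lines(1)) (rule line, simp flip: quat_coordinate_lines(1))
  show "(\<lambda>t. f (Quat (qa q) t (qc q) (qd q))) differentiable (at (qb q))"
    by (subst quat_coordinate_lines(2)) (rule line, simp flip: quat_coordinate_lines(2))
  show "(\<lambda>t. f (Quat (qa q) (qb q) t (qd q))) differentiable (at (qc q))"
    by (subst quat_coordinate_lines(3)) (rule line, simp flip: quat_coordinate_lines(3))
  show "(\<lambda>t. f (Quat (qa q) (qb q) (qc q) t)) differentiable (at (qd q))"
    by (subst quat_coordinate_lines(4)) (rule line, simp flip: quat_coordinate_lines(4))
qed

lemma real_grad_mult: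
  assumes "f differentiable (at q)" and "g differentiable (at q)"
  shows "real_grad (\<lambda>x. f x * g x) q = f q *s real_grad g q + right_mult (real_grad f q) (g q)"
  by (simp add: vec_eq_iff forall_4 real_grad_def right_mult_def vector_4_nth
      vector_derivative_mult differentiable_on_coordinate_lines assms)

text \<open>Both \<open>*s\<close> and \<open>v*\<close> multiply from the left here, so this is associativity and holds
  without commutativity; a factor on the right of the entries of \<open>v\<close> would be stuck between
  them and those of \<open>A\<close>.\<close>

lemma scalar_vector_matrix_mult:
  fixes v :: "'a::semiring_1 ^ 'n"
  shows "(c *s v) v* A = c *s (v v* A)"
  by (simp add: vec_eq_iff vector_matrix_mult_def sum_distrib_left mult.assoc)

theorem mainTheorem7:
  fixes f g :: "quat \<Rightarrow> quat"
  assumes "\<And>q. f differentiable (at q)"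
    and "\<And>q. g differentiable (at q)"
  shows "\<forall>q. HR_grad (\<lambda>x. f x * g x) q =
    f q *s HR_grad g q + right_mult (real_grad f q) (g q) v* hermitian_transpose J"
  by (simp add: HR_grad_def real_grad_mult assms scalar_vector_matrix_mult
      vector_matrix_left_distrib)

end
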